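(* Let $G$ be a graph with $n$ vertices and $m$ edges, without isolated vertices, and with nullity $\eta(G)=\kappa$. Then $$\mathcal{E}(G)\ \geq\ \sqrt{2m+(n-\kappa)(n-\kappa-1)\,\bigl|\Upsilon_{n-\kappa}(G)\bigr|^{\frac{2}{n-\kappa}}}.$$ Equality holds if and only if all the nonzero eigenvalues of $G$ have the same absolute value. Moreover, if $G$ is connected, equality holds if and only if $G$ is a complete bipartite graph $K_{a,b}$ with $a+b=\kappa+2$. If $G$ is not connected, equality holds if and only if $G=\bigcup_{j=1}^{\ell}K_{a_j,b_j}$ (disjoint union) with $a_jb_j=a_ib_i$ for $i\neq j$, $\ell=\frac{n-\kappa}{2}$ and $n=\sum_{j=1}^{\ell}(a_j+b_j)$.
   Context: Graphs are finite, undirected and simple. The eigenvalues of $G$ are those of its adjacency matrix $A(G)$. The energy $\mathcal{E}(G)$ is the sum of the absolute values of the eigenvalues of $G$, counted with multiplicity. The nullity $\eta(G)$ is the multiplicity of $0$ as an eigenvalue of $A(G)$. For a square matrix $M$ of order $n$ with eigenvalues $\mu_1,\dots,\mu_n$, $\Upsilon_k(M)=\sum_{1\le i_1<\cdots<i_k\le n}\mu_{i_1}\cdots\mu_{i_k}$, and $\Upsilon_{n-\kappa}(G)=\Upsilon_{n-\kappa}(A(G))$. $K_{a,b}$ denotes the complete bipartite graph with parts of sizes $a,b\geq 1$; equality of graphs means isomorphism. *)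

theory Defs
  imports
    "Graph_Theory.Graph_Theory"
    "Jordan_Normal_Form.Char_Poly"
    "HOL-Library.Disjoint_Sets"
begin

text \<open>
  Finite simple graphs are rendered by the locale \<open>pair_graph\<close>: a finite vertex set
  \<open>pverts G\<close> together with a finite, symmetric and irreflexive set \<open>parcs G\<close> of ordered pairs.
  Every undirected edge therefore corresponds to two arcs, and edges are counted as
  unordered pairs.
\<close>

definition edges :: "'a pair_pre_digraph \<Rightarrow> 'a set set" where
  "edges G = {{u, v} | u v. (u, v) \<in> parcs G}"

text \<open>
  The adjacency matrix depends on an enumeration of the vertices. The graph invariants below
  use an arbitrary fixed one; by \<open>char_poly_adj_matrix\<close> the characteristic polynomial,
  and with it the spectrum with multiplicities, does not depend on that choice.
  The entries are complex, so that the characteristic polynomial splits into linear factors.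
\<close>

definition adj_matrix_wrt :: "'a list \<Rightarrow> 'a pair_pre_digraph \<Rightarrow> complex mat" where
  "adj_matrix_wrt vs G =
     mat (length vs) (length vs) (\<lambda>(i, j). if (vs ! i, vs ! j) \<in> parcs G then 1 else 0)"

definition adj_matrix :: "'a pair_pre_digraph \<Rightarrow> complex mat" where
  "adj_matrix G = adj_matrix_wrt (SOME vs. distinct vs \<and> set vs = pverts G) G"

text \<open>The eigenvalues of a square matrix, listed with algebraic multiplicity in some order.\<close>

definition eigvals :: "complex mat \<Rightarrow> complex list" where
  "eigvals M = (SOME \<mu>s. char_poly M = (\<Prod>\<mu>\<leftarrow>\<mu>s. [:- \<mu>, 1:]))"

definition Upsilon :: "nat \<Rightarrow> complex mat \<Rightarrow> complex" where
  "Upsilon k M = (\<Sum>I \<in> {I. I \<subseteq> {..<length (eigvals M)} \<and> card I = k}. \<Prod>i\<in>I. eigvals M ! i)"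

definition energy :: "'a pair_pre_digraph \<Rightarrow> real" where
  "energy G = (\<Sum>\<mu>\<leftarrow>eigvals (adj_matrix G). cmod \<mu>)"

definition nullity :: "'a pair_pre_digraph \<Rightarrow> nat" where
  "nullity G = order 0 (char_poly (adj_matrix G))"

definition is_disjoint_union ::
    "'a pair_pre_digraph \<Rightarrow> 'i set \<Rightarrow> ('i \<Rightarrow> 'a pair_pre_digraph) \<Rightarrow> bool" where
  "is_disjoint_union G I H \<longleftrightarrow>
     disjoint_family_on (\<lambda>i. pverts (H i)) I \<and>
     pverts G = (\<Union>i\<in>I. pverts (H i)) \<and>
     parcs G = (\<Union>i\<in>I. parcs (H i))"

lemma eigvals:
  assumes "M \<in> carrier_mat n n"
  shows "char_poly M = (\<Prod>\<mu>\<leftarrow>eigvals M. [:- \<mu>, 1:])" and "length (eigvals M) = n"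
proof -
  obtain as where "char_poly M = (\<Prod>a\<leftarrow>as. [:- a, 1:])"
    using char_poly_factorized[OF assms] by auto
  then show *: "char_poly M = (\<Prod>\<mu>\<leftarrow>eigvals M. [:- \<mu>, 1:])"
    unfolding eigvals_def by (rule someI)
  have "degree (\<Prod>\<mu>\<leftarrow>\<mu>s. [:- \<mu>, 1:]) = length \<mu>s" for \<mu>s :: "complex list"
    by (rule degree_linear_factors)
  then show "length (eigvals M) = n"
    using * degree_monic_char_poly[OF assms] by metis
qed

lemma char_poly_adj_matrix_wrt_cong:
  assumes "distinct vs" "distinct ws" "set vs = set ws"
  shows "char_poly (adj_matrix_wrt vs G) = char_poly (adj_matrix_wrt ws G)"
proof -
  define n where "n = length vs"
  have n: "length vs = n" "length ws = n"
    using assms distinct_card[of vs] distinct_card[of ws] by (auto simp: n_def)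
  define P where "P xs ys = mat n n (\<lambda>(i, j). if xs ! i = ys ! j then 1 else 0 :: complex)"
    for xs ys :: "'a list"
  have sel: "(\<Sum>k<n. (if x = ys ! k then 1 else 0) * f (ys ! k)) = f x"
    if "distinct ys" "length ys = n" "x \<in> set ys" for x and ys :: "'a list" and f :: "'a \<Rightarrow> complex"
  proof -
    have "(\<Sum>k<n. (if x = ys ! k then 1 else 0) * f (ys ! k)) =
          (\<Sum>y\<in>set ys. (if x = y then 1 else 0) * f y)"
      by (rule sum.reindex_bij_betw[OF bij_betw_nth]) (use that in auto)
    also have "\<dots> = (\<Sum>y\<in>set ys. if x = y then f y else 0)"
      by (rule sum.cong) auto
    also have "\<dots> = f x"
      using that by simp
    finally show ?thesis .
  qed
  have sel': "(\<Sum>k<n. f (ys ! k) * (if ys ! k = x then 1 else 0)) = f x"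
    if "distinct ys" "length ys = n" "x \<in> set ys" for x and ys :: "'a list" and f :: "'a \<Rightarrow> complex"
    using sel[OF that, of f] by (simp add: eq_commute mult.commute)
  have PP: "P xs ys * P ys xs = 1\<^sub>m n"
    if "distinct xs" "distinct ys" "length xs = n" "length ys = n" "set xs = set ys" for xs ys
  proof (rule eq_matI)
    fix i j assume ij: "i < dim_row (1\<^sub>m n :: complex mat)" "j < dim_col (1\<^sub>m n :: complex mat)"
    have "(P xs ys * P ys xs) $$ (i, j) =
        (\<Sum>k<n. (if xs ! i = ys ! k then 1 else 0) * (if ys ! k = xs ! j then 1 else 0))"
      using ij by (simp add: P_def scalar_prod_def atLeast0LessThan)
    also have "\<dots> = (if xs ! i = xs ! j then 1 else 0)"
      by (rule sel) (use that ij nth_mem[of i xs] in auto)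
    finally show "(P xs ys * P ys xs) $$ (i, j) = 1\<^sub>m n $$ (i, j)"
      using that ij by (simp add: nth_eq_iff_index_eq)
  qed (auto simp: P_def)
  let ?A = "\<lambda>xs. adj_matrix_wrt xs G"
  have "?A vs = P vs ws * ?A ws * P ws vs"
  proof (rule eq_matI)
    fix i j assume "i < dim_row (P vs ws * ?A ws * P ws vs)" "j < dim_col (P vs ws * ?A ws * P ws vs)"
    then have ij: "i < n" "j < n" by (auto simp: P_def)
    define a :: "'a \<Rightarrow> 'a \<Rightarrow> complex" where "a x y = (if (x, y) \<in> parcs G then 1 else 0)" for x y
    have mem: "vs ! i \<in> set ws" "vs ! j \<in> set ws"
      using ij n assms nth_mem[of i vs] nth_mem[of j vs] by auto
    have row: "(P vs ws * ?A ws) $$ (i, k) = a (vs ! i) (ws ! k)" if "k < n" for k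
    proof -
      have "(P vs ws * ?A ws) $$ (i, k) =
          (\<Sum>l<n. (if vs ! i = ws ! l then 1 else 0) * a (ws ! l) (ws ! k))"
        using ij n that
        by (simp add: P_def adj_matrix_wrt_def scalar_prod_def atLeast0LessThan a_def)
      then show ?thesis
        using sel[OF assms(2) n(2) mem(1), of "\<lambda>x. a x (ws ! k)"] by simp
    qed
    have "(P vs ws * ?A ws * P ws vs) $$ (i, j) =
        (\<Sum>k<n. (P vs ws * ?A ws) $$ (i, k) * P ws vs $$ (k, j))"
      using ij n by (simp add: P_def adj_matrix_wrt_def scalar_prod_def atLeast0LessThan)
    also have "\<dots> = (\<Sum>k<n. a (vs ! i) (ws ! k) * (if ws ! k = vs ! j then 1 else 0))"
      by (rule sum.cong[OF refl], subst row) (use ij in \<open>auto simp: P_def\<close>)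
    also have "\<dots> = a (vs ! i) (vs ! j)"
      by (rule sel'[OF assms(2) n(2) mem(2)])
    finally show "?A vs $$ (i, j) = (P vs ws * ?A ws * P ws vs) $$ (i, j)"
      using ij n by (simp add: adj_matrix_wrt_def a_def)
  qed (use n in \<open>auto simp: P_def adj_matrix_wrt_def\<close>)
  then have "similar_mat_wit (?A vs) (?A ws) (P vs ws) (P ws vs)"
    using assms n PP[of vs ws] PP[of ws vs]
    by (auto simp: similar_mat_wit_def Let_def P_def adj_matrix_wrt_def)
  then show ?thesis
    by (intro char_poly_similar) (auto simp: similar_mat_def)
qed

lemma char_poly_adj_matrix:
  assumes "distinct vs" "set vs = pverts G"
  shows "char_poly (adj_matrix G) = char_poly (adj_matrix_wrt vs G)"
proof -
  let ?ws = "SOME vs. distinct vs \<and> set vs = pverts G"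
  have "distinct ?ws \<and> set ?ws = pverts G"
    by (rule someI[of _ vs]) (use assms in simp)
  then show ?thesis
    unfolding adj_matrix_def using assms by (intro char_poly_adj_matrix_wrt_cong) auto
qed

end

theory Submission
  imports Defs "Jordan_Normal_Form.Schur_Decomposition"
begin

text \<open>
  The square of the energy is \<open>2m\<close> plus the sum of \<open>\<bar>\<lambda>\<^sub>i\<bar> \<bar>\<lambda>\<^sub>j\<bar>\<close> over ordered pairs \<open>i \<noteq> j\<close> of nonzero
  eigenvalues, and AM-GM bounds that sum by the geometric mean of its terms. If all nonzero
  eigenvalues have square \<open>c\<close>, then \<open>A\<^sup>3 = c A\<close>: there are exactly \<open>c\<close> walks of length 3 between adjacent
  vertices and none between non-adjacent ones. Hence there are no triangles, the ends of every walk
  of length 3 are adjacent, and so every component is some \<open>K\<^bsub>a,b\<^esub>\<close> with \<open>ab = c\<close>. The number of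
  components is half the rank because \<open>(n - \<kappa>) c\<close> and \<open>2 \<ell> c\<close> both equal the trace of \<open>A\<^sup>2\<close>.
\<close>

subsection \<open>The arithmetic-geometric mean inequality for pairs\<close>

text \<open>Squaring the sum leaves the products of distinct entries, whose geometric mean is
  \<open>g\<close>. Dividing by the geometric mean of the entries makes the logarithms of these
  products sum to zero, so \<open>ln z \<le> z - 1\<close> applied termwise gives the bound. For
  \<open>N = 2\<close> the two ordered products coincide, so equality is automatic.\<close>

lemma offdiag_sum_AM_GM:
  fixes x :: "'i \<Rightarrow> real"
  assumes fin: "finite I" and pos: "\<And>i. i \<in> I \<Longrightarrow> x i > 0" and "card I = N"
  defines "g \<equiv> (\<Prod>i\<in>I. x i) powr (2 / real N)"
  shows "(\<Sum>i\<in>I. (x i)\<^sup>2) + real N * (real N - 1) * g \<le> (\<Sum>i\<in>I. x i)\<^sup>2" (is "?le")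
    and "(\<Sum>i\<in>I. x i)\<^sup>2 = (\<Sum>i\<in>I. (x i)\<^sup>2) + real N * (real N - 1) * g \<longleftrightarrow>
      N = 2 \<or> (\<forall>i\<in>I. \<forall>j\<in>I. x i = x j)" (is "?eq")
proof -
  \<comment> \<open>\<open>t\<close> is the logarithm of the geometric mean, so that
    \<open>g\<close> becomes \<open>exp t ^ 2\<close>.\<close>
  define t where "t = (\<Sum>i\<in>I. ln (x i)) / N"
  have "?le \<and> ?eq"
  proof (cases "I = {}")
    case True
    then show ?thesis using \<open>card I = N\<close> by simp
  next
    case False
    then have N: "N > 0" using fin \<open>card I = N\<close> by auto
    define y where "y i = x i / exp t" for i
    have y: "y i > 0" if "i \<in> I" for i using pos[OF that] by (simp add: y_def)
    have lny: "ln (y i) = ln (x i) - t" if "i \<in> I" for i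
      using pos[OF that] by (simp add: y_def ln_div)
    have prod_pos: "(\<Prod>i\<in>I. x i) > 0" using pos by (simp add: prod_pos)
    have "ln (\<Prod>i\<in>I. x i) = (\<Sum>i\<in>I. ln (x i))"
      using fin pos by (intro ln_prod) (auto dest: pos)
    then have g: "g = exp t ^ 2"
      using prod_pos N by (simp add: g_def powr_def t_def mult_ac flip: exp_double)
    have lny_sum: "(\<Sum>i\<in>I. ln (y i)) = 0"
      using N \<open>card I = N\<close> by (simp add: lny sum_subtractf t_def)
    define P where "P = (SIGMA i:I. I - {i})"
    have finP: "finite P" using fin by (auto simp: P_def)
    have cardP: "real (card P) = real N * (real N - 1)"
      using fin \<open>card I = N\<close> N
      by (simp add: P_def card_SigmaI card_Diff_singleton of_nat_diff)
    have split: "(\<Sum>i\<in>I. f i)\<^sup>2 = (\<Sum>i\<in>I. (f i)\<^sup>2) + (\<Sum>(i,j)\<in>P. f i * f j)"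
      for f :: "'i \<Rightarrow> real"
    proof -
      have "(\<Sum>i\<in>I. f i)\<^sup>2 = (\<Sum>i\<in>I. \<Sum>j\<in>I. f i * f j)"
        by (simp add: power2_eq_square sum_product)
      also have "\<dots> = (\<Sum>i\<in>I. (f i)\<^sup>2 + (\<Sum>j\<in>I - {i}. f i * f j))"
        by (rule sum.cong[OF refl]) (simp add: sum.remove[OF fin] power2_eq_square)
      finally show ?thesis
        using fin by (simp add: sum.distrib P_def sum.Sigma)
    qed
    \<comment> \<open>Every index occurs in \<open>2 * (N - 1)\<close> of the ordered pairs, so this
      sum is a multiple of the vanishing sum of all \<open>ln (y i)\<close>.\<close>
    have lnP: "(\<Sum>(i,j)\<in>P. ln (y i * y j)) = 0"
    proof -
      have "(\<Sum>(i,j)\<in>P. ln (y i * y j)) = (\<Sum>i\<in>I. \<Sum>j\<in>I - {i}. ln (y i) + ln (y j))"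
      proof -
        have "(\<Sum>(i,j)\<in>P. ln (y i * y j)) = (\<Sum>i\<in>I. \<Sum>j\<in>I - {i}. ln (y i * y j))"
          unfolding P_def using fin by (simp add: sum.Sigma)
        also have "\<dots> = (\<Sum>i\<in>I. \<Sum>j\<in>I - {i}. ln (y i) + ln (y j))"
          by (intro sum.cong refl ln_mult_pos) (simp_all add: y)
        finally show ?thesis .
      qed
      also have "\<dots> = (\<Sum>i\<in>I. (real N - 1) * ln (y i) + ((\<Sum>j\<in>I. ln (y j)) - ln (y i)))"
      proof (rule sum.cong[OF refl])
        fix i assume i: "i \<in> I"
        have "(\<Sum>j\<in>I - {i}. ln (y i) + ln (y j)) =
            real (card (I - {i})) * ln (y i) + (\<Sum>j\<in>I - {i}. ln (y j))"
          unfolding sum.distrib sum_constant ..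
        also have "(\<Sum>j\<in>I - {i}. ln (y j)) = (\<Sum>j\<in>I. ln (y j)) - ln (y i)"
          using sum.remove[OF fin i, of "\<lambda>j. ln (y j)"] by linarith
        also have "real (card (I - {i})) = real N - 1"
          using i fin \<open>card I = N\<close> N by (simp add: of_nat_diff)
        finally show "(\<Sum>j\<in>I - {i}. ln (y i) + ln (y j)) =
            (real N - 1) * ln (y i) + ((\<Sum>j\<in>I. ln (y j)) - ln (y i))" .
      qed
      also have "\<dots> = 0"
        by (simp add: sum.distrib sum_subtractf lny_sum flip: sum_distrib_left)
      finally show ?thesis .
    qed
    \<comment> \<open>The slack in \<open>ln z \<le> z - 1\<close>, summed over the pairs. As the
      logarithms cancel, \<open>g * d\<close> is exactly the gap between the two sides.\<close>
    define d where "d = (\<Sum>(i,j)\<in>P. y i * y j - 1 - ln (y i * y j))"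
    have d: "d = (\<Sum>(i,j)\<in>P. y i * y j) - real N * (real N - 1)"
      using lnP cardP by (simp add: d_def case_prod_unfold sum_subtractf)
    have "(\<Sum>(i,j)\<in>P. x i * x j) = g * (\<Sum>(i,j)\<in>P. y i * y j)"
      unfolding sum_distrib_left
      by (rule sum.cong) (auto simp: y_def g power2_eq_square)
    then have diff: "(\<Sum>i\<in>I. x i)\<^sup>2 - ((\<Sum>i\<in>I. (x i)\<^sup>2) + real N * (real N - 1) * g) = g * d"
      by (simp add: split d algebra_simps)
    have "g > 0" by (simp add: g)
    have summand_nonneg: "(case p of (i, j) \<Rightarrow> y i * y j - 1 - ln (y i * y j)) \<ge> 0" if "p \<in> P" for p
      using that y ln_le_minus_one[of "y (fst p) * y (snd p)"]
      by (auto simp: P_def)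
    have "d \<ge> 0" unfolding d_def by (rule sum_nonneg) (use summand_nonneg in auto)
    have "d = 0 \<longleftrightarrow> (\<forall>(i,j)\<in>P. y i * y j - 1 - ln (y i * y j) = 0)"
      unfolding d_def using sum_nonneg_eq_0_iff[OF finP summand_nonneg] by (auto simp: case_prod_unfold)
    also have "\<dots> \<longleftrightarrow> (\<forall>(i,j)\<in>P. y i * y j = 1)"
    proof -
      have "y i * y j - 1 - ln (y i * y j) = 0 \<longleftrightarrow> y i * y j = 1" if "(i, j) \<in> P" for i j
        using that y ln_eq_minus_one[of "y i * y j"] by (auto simp: P_def)
      then show ?thesis by auto
    qed
    also have "\<dots> \<longleftrightarrow> N = 2 \<or> (\<forall>i\<in>I. \<forall>j\<in>I. x i = x j)" (is "?L \<longleftrightarrow> _ \<or> ?R")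
    proof (intro iffI; (elim disjE)?)
      assume L: ?L
      show "N = 2 \<or> ?R"
      proof (cases "N = 2")
        case False
        have "x i = x j" if ij: "i \<in> I" "j \<in> I" "i \<noteq> j" for i j
        proof -
          \<comment> \<open>A third index \<open>k\<close> is available, and both \<open>y i\<close>
            and \<open>y j\<close> are the inverse of \<open>y k\<close>.\<close>
          have "I \<noteq> {i, j}" using False \<open>card I = N\<close> ij by auto
          then obtain k where k: "k \<in> I" "k \<noteq> i" "k \<noteq> j"
            using ij by blast
          then have "y i * y k = y j * y k" using L ij by (auto simp: P_def)
          then show ?thesis using pos[OF k(1)] by (simp add: y_def)
        qed
        then show ?thesis by metis
      qed simp
    next
      assume "N = 2"
      then obtain a b where ab: "I = {a, b}" "a \<noteq> b"
        using \<open>card I = N\<close> by (meson card_2_iff)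
      \<comment> \<open>With two indices the normalization itself says that the only product is
        1.\<close>
      then have "ln (y a * y b) = 0"
        using lny_sum y by (simp add: ln_mult)
      moreover have "y a * y b > 0" using y ab by simp
      ultimately have "y a * y b = 1" by simp
      then show ?L using ab by (auto simp: P_def mult.commute)
    next
      assume R: ?R
      obtain i where i: "i \<in> I" using False by auto
      have "ln (y j) = ln (y i)" if "j \<in> I" for j
        using R i that unfolding y_def by metis
      then have "(\<Sum>j\<in>I. ln (y j)) = real N * ln (y i)"
        using \<open>card I = N\<close> by simp
      then have "y i = 1" using lny_sum N y[OF i] by simp
      then have "y j = 1" if "j \<in> I" for j using R i that unfolding y_def by metis
      then show ?L by (auto simp: P_def)
    qed
    finally show ?thesis
      using diff \<open>g > 0\<close> \<open>d \<ge> 0\<close> by (auto simp: algebra_simps)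
  qed
  then show ?le ?eq by blast+
qed

subsection \<open>Traces of powers\<close>

definition mat_trace :: "'a :: comm_semiring_0 mat \<Rightarrow> 'a" where
  "mat_trace M = (\<Sum>i<dim_row M. M $$ (i, i))"

lemma mat_trace_mult:
  assumes "X \<in> carrier_mat n k" "Y \<in> carrier_mat k n"
  shows "mat_trace (X * Y) = (\<Sum>i<n. \<Sum>j<k. X $$ (i, j) * Y $$ (j, i))"
  using assms by (simp add: mat_trace_def scalar_prod_def atLeast0LessThan)

lemma mat_trace_mult_commute:
  assumes "X \<in> carrier_mat n k" "Y \<in> carrier_mat k n"
  shows "mat_trace (X * Y) = mat_trace (Y * X)"
  unfolding mat_trace_mult[OF assms] mat_trace_mult[OF assms(2,1)]
  by (subst sum.swap) (simp add: mult.commute)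

text \<open>Cyclicity of the trace moves \<open>P\<close> to the right end, where
  \<open>Q * P\<close> is the identity.\<close>

lemma mat_trace_similar:
  fixes X Y :: "'a :: comm_ring_1 mat"
  assumes "similar_mat_wit X Y P Q"
  shows "mat_trace X = mat_trace Y"
proof -
  define n where "n = dim_row X"
  note w = similar_mat_witD[OF n_def assms]
  have "mat_trace X = mat_trace (P * (Y * Q))"
    using w by (simp add: assoc_mult_mat[of _ n n _ n _ n])
  also have "\<dots> = mat_trace ((Y * Q) * P)"
    by (rule mat_trace_mult_commute) (use w in auto)
  also have "(Y * Q) * P = Y"
    using w by (simp add: assoc_mult_mat[of _ n n _ n _ n])
  finally show ?thesis .
qed

text \<open>For \<open>j \<le> i\<close>, the terms with \<open>k < i\<close> have a zero factor
  from \<open>X\<close> and those with \<open>k > i\<close> one from \<open>Y\<close>, so only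
  \<open>k = i\<close> can contribute. Diagonals of powers can therefore be computed
  entrywise.\<close>

lemma upper_triangular_mult_entry:
  fixes X Y :: "'a :: comm_ring_1 mat"
  assumes "X \<in> carrier_mat n n" "Y \<in> carrier_mat n n"
    and "upper_triangular X" "upper_triangular Y" "j \<le> i" "i < n"
  shows "(X * Y) $$ (i, j) = (if i = j then X $$ (i, i) * Y $$ (i, i) else 0)"
proof -
  have "(X * Y) $$ (i, j) = (\<Sum>k<n. X $$ (i, k) * Y $$ (k, j))"
    using assms by (simp add: scalar_prod_def atLeast0LessThan)
  also have "\<dots> = (\<Sum>k<n. if k = i then (if i = j then X $$ (i, i) * Y $$ (i, i) else 0) else 0)"
  proof (rule sum.cong[OF refl])
    fix k assume k: "k \<in> {..<n}"
    consider "k < i" | "k > i" | "k = i" "j < i" | "k = i" "j = i"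
      using \<open>j \<le> i\<close> by linarith
    then show "X $$ (i, k) * Y $$ (k, j) =
      (if k = i then (if i = j then X $$ (i, i) * Y $$ (i, i) else 0) else 0)"
      using assms k by cases (auto simp: upper_triangular_def)
  qed
  also have "\<dots> = (if i = j then X $$ (i, i) * Y $$ (i, i) else 0)"
    using assms by simp
  finally show ?thesis .
qed

lemma upper_triangular_pow:
  fixes X :: "'a :: comm_ring_1 mat"
  assumes "X \<in> carrier_mat n n" "upper_triangular X"
  shows "upper_triangular (X ^\<^sub>m k) \<and> (\<forall>i<n. (X ^\<^sub>m k) $$ (i, i) = X $$ (i, i) ^ k)"
proof (induction k)
  case 0
  then show ?case using assms by (auto simp: upper_triangular_def)
next
  case (Suc k)
  have "X ^\<^sub>m k \<in> carrier_mat n n" using assms by simp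
  note e = upper_triangular_mult_entry[OF this assms(1) _ assms(2)]
  show ?case
    using Suc e assms by (auto simp: upper_triangular_def mult.commute)
qed

text \<open>Schur's triangular form carries the list \<open>eigvals M\<close> on its diagonal, in
  the same order. Power sums of eigenvalues thus become traces for an arbitrary complex square
  matrix.\<close>

lemma mat_trace_pow_eigvals:
  assumes M: "M \<in> carrier_mat n n"
  shows "mat_trace (M ^\<^sub>m k) = (\<Sum>i<n. (eigvals M ! i) ^ k)"
proof -
  obtain B P Q where *: "schur_decomposition M (eigvals M) = (B, P, Q)"
    by (metis prod_cases3)
  have s: "similar_mat_wit M B P Q" and u: "upper_triangular B" and d: "diag_mat B = eigvals M"
    using schur_decomposition[OF M eigvals(1)[OF M] *] by auto
  have B: "B \<in> carrier_mat n n"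
    using similar_mat_witD2[OF M s] by simp
  have nth: "eigvals M ! i = B $$ (i, i)" if "i < n" for i
    using that B unfolding d[symmetric] diag_mat_def by simp
  have "mat_trace (M ^\<^sub>m k) = mat_trace (B ^\<^sub>m k)"
    by (rule mat_trace_similar[OF similar_mat_wit_pow[OF s]])
  also have "\<dots> = (\<Sum>i<n. B $$ (i, i) ^ k)"
    using upper_triangular_pow[OF B u, of k] B by (simp add: mat_trace_def)
  finally show ?thesis by (simp add: nth)
qed

lemma pow_mat_add:
  fixes X :: "'a :: semiring_1 mat"
  assumes "X \<in> carrier_mat n n"
  shows "X ^\<^sub>m (k + l) = X ^\<^sub>m k * X ^\<^sub>m l"
proof (induction l)
  case 0
  then show ?case using right_mult_one_mat[OF pow_carrier_mat[OF assms, of k]] assms by simp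
next
  case (Suc l)
  then show ?case
    using assms by (simp add: assoc_mult_mat[of _ n n _ n _ n])
qed

subsection \<open>Eigenvalues\<close>

text \<open>Connects roots of the characteristic polynomial with positions in the chosen list, over
  which the later sums run.\<close>

lemma eigenvalue_iff_eigvals:
  assumes M: "M \<in> carrier_mat n n"
  shows "eigenvalue M \<mu> \<longleftrightarrow> (\<exists>i<n. eigvals M ! i = \<mu>)"
proof -
  have "eigenvalue M \<mu> \<longleftrightarrow> poly (\<Prod>\<mu>\<leftarrow>eigvals M. [:- \<mu>, 1:]) \<mu> = 0"
    using eigenvalue_root_char_poly[OF M] eigvals(1)[OF M] by simp
  also have "\<dots> \<longleftrightarrow> \<mu> \<in> set (eigvals M)"
    by (auto simp: poly_prod_list prod_list_zero_iff)
  finally show ?thesis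
    using eigvals(2)[OF M] by (auto simp: in_set_conv_nth)
qed

text \<open>Each linear factor contributes one to the order at its own root. At zero this turns the
  nullity into a count of list positions.\<close>

lemma order_char_poly_eq_card:
  assumes M: "M \<in> carrier_mat n n"
  shows "Polynomial.order x (char_poly M) = card {i. i < n \<and> eigvals M ! i = x}"
proof -
  have "Polynomial.order x (\<Prod>\<mu>\<leftarrow>\<mu>s. [:- \<mu>, 1:]) = length (filter (\<lambda>\<mu>. \<mu> = x) \<mu>s)" for \<mu>s
  proof (induction \<mu>s)
    case (Cons \<mu> \<mu>s)
    have "[:- \<mu>, 1:] * (\<Prod>\<mu>\<leftarrow>\<mu>s. [:- \<mu>, 1:]) \<noteq> 0"
      by (auto simp: prod_list_zero_iff simp del: mult_pCons_left)
    then show ?case using Cons by (auto simp: order_mult order_linear' simp del: mult_pCons_left)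
  qed simp
  then show ?thesis
    using eigvals[OF M] by (simp add: length_filter_conv_card)
qed

text \<open>The Hermitian form \<open>S\<close> of an eigenvector is \<mu> times its squared norm
  \<open>T\<close>. Symmetry and real entries make \<open>S\<close> its own conjugate, and
  \<open>T\<close> is nonzero.\<close>

lemma eigenvalue_symmetric_real:
  fixes M :: "complex mat"
  assumes M: "M \<in> carrier_mat n n"
    and sym: "\<And>i j. i < n \<Longrightarrow> j < n \<Longrightarrow> M $$ (i, j) = M $$ (j, i)"
    and real: "\<And>i j. i < n \<Longrightarrow> j < n \<Longrightarrow> M $$ (i, j) \<in> \<real>"
    and ev: "eigenvalue M \<mu>"
  shows "\<mu> \<in> \<real>"
proof -
  obtain v where v: "v \<in> carrier_vec n" "v \<noteq> 0\<^sub>v n" "M *\<^sub>v v = \<mu> \<cdot>\<^sub>v v"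
    using ev M by (auto simp: eigenvalue_def eigenvector_def)
  have e: "(\<Sum>j<n. M $$ (i, j) * v $ j) = \<mu> * v $ i" if "i < n" for i
  proof -
    have "(M *\<^sub>v v) $ i = (\<Sum>j<n. M $$ (i, j) * v $ j)"
      using M v(1) that by (simp add: scalar_prod_def atLeast0LessThan)
    then show ?thesis using v that by simp
  qed
  define S where "S = (\<Sum>i<n. cnj (v $ i) * (\<Sum>j<n. M $$ (i, j) * v $ j))"
  define T where "T = (\<Sum>i<n. (cmod (v $ i))\<^sup>2)"
  have "S = (\<Sum>i<n. \<mu> * of_real ((cmod (v $ i))\<^sup>2))"
    unfolding S_def
  proof (rule sum.cong[OF refl])
    fix i assume "i \<in> {..<n}"
    then have "i < n" by simp
    show "cnj (v $ i) * (\<Sum>j<n. M $$ (i, j) * v $ j) = \<mu> * of_real ((cmod (v $ i))\<^sup>2)"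
      unfolding e[OF \<open>i < n\<close>] complex_norm_square by (simp add: mult_ac)
  qed
  then have S: "S = \<mu> * of_real T"
    by (simp add: T_def sum_distrib_left)
  have "cnj S = (\<Sum>i<n. \<Sum>j<n. v $ i * (cnj (M $$ (i, j)) * cnj (v $ j)))"
    by (simp add: S_def sum_distrib_left)
  also have "\<dots> = (\<Sum>i<n. \<Sum>j<n. v $ i * (M $$ (j, i) * cnj (v $ j)))"
  proof (intro sum.cong refl)
    fix i j assume "i \<in> {..<n}" "j \<in> {..<n}"
    then show "v $ i * (cnj (M $$ (i, j)) * cnj (v $ j)) = v $ i * (M $$ (j, i) * cnj (v $ j))"
      using real[of i j] sym[of i j] by (simp add: Reals_cnj_iff)
  qed
  also have "\<dots> = S"
    unfolding S_def sum_distrib_left by (subst sum.swap) (simp add: mult_ac)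
  finally have "cnj S = S" .
  moreover have "T \<noteq> 0"
  proof
    assume "T = 0"
    then have "v $ i = 0" if "i < n" for i
      using that unfolding T_def by (subst (asm) sum_nonneg_eq_0_iff) auto
    then have "v = 0\<^sub>v n" using v(1) by (intro eq_vecI) auto
    with v(2) show False by simp
  qed
  ultimately show ?thesis
    by (simp add: S Reals_cnj_iff)
qed

subsection \<open>Walks of length three\<close>

text \<open>Only the two inner vertices of a walk are recorded, and they may coincide with its ends.
  These numbers are the entries of the cube of the adjacency matrix.\<close>

definition walks3 :: "'a rel \<Rightarrow> 'a \<Rightarrow> 'a \<Rightarrow> nat" where
  "walks3 E u v = card {(x, y). (u, x) \<in> E \<and> (x, y) \<in> E \<and> (y, v) \<in> E}"

lemma finite_walks3:
  assumes "finite E"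
  shows "finite {(x, y). (u, x) \<in> E \<and> (x, y) \<in> E \<and> (y, v) \<in> E}"
  by (rule finite_subset[OF _ assms]) auto

lemma walks3_pos:
  assumes "finite E" "(u, x) \<in> E" "(x, y) \<in> E" "(y, v) \<in> E"
  shows "walks3 E u v > 0"
  unfolding walks3_def using assms finite_walks3[OF assms(1), of u v]
  by (auto simp: card_gt_0_iff)

lemma walks3_commute:
  assumes "sym E"
  shows "walks3 E u v = walks3 E v u"
proof -
  define S where "S a b = {(x, y). (a, x) \<in> E \<and> (x, y) \<in> E \<and> (y, b) \<in> E}" for a b
  \<comment> \<open>Reversing a walk exchanges its inner vertices. Using the inclusion in both
    directions turns it into an equality.\<close>
  have sub: "prod.swap ` S a b \<subseteq> S b a" for a b
    using assms unfolding S_def sym_def by auto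
  have "S v u = prod.swap ` prod.swap ` S v u" by (simp add: image_comp)
  also have "\<dots> \<subseteq> prod.swap ` S u v" by (intro image_mono sub)
  finally have "S v u = prod.swap ` S u v" using sub by blast
  then have "card (S v u) = card (S u v)" by (simp add: card_image)
  then show ?thesis by (simp add: walks3_def S_def)
qed

text \<open>The ends of every walk of length three are adjacent (\<open>closed\<close>). A common
  neighbour \<open>x\<close> of \<open>u\<close> and \<open>v\<close> would give the walk x, u, v, x
  and hence a loop. The walks x, v, u, y join all of \<open>A\<close> to all of \<open>B\<close>;
  conversely the walks w, x, v, u and w, y, u, v confine the neighbours of \<open>x\<close> in
  \<open>A\<close> to \<open>B\<close> and those of \<open>y\<close> in \<open>B\<close> to
  \<open>A\<close>.\<close>

lemma neighbourhoods_complete_bipartite: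
  assumes fin: "finite E" and sym: "sym E" and ir: "\<And>x. (x, x) \<notin> E"
    and walks: "\<And>u v. real (walks3 E u v) = (if (u, v) \<in> E then c else 0)"
    and uv: "(u, v) \<in> E"
  defines "A \<equiv> E `` {v}" and "B \<equiv> E `` {u}"
  shows "A \<inter> B = {}" and "\<And>x. x \<in> A \<Longrightarrow> E `` {x} = B" and "\<And>y. y \<in> B \<Longrightarrow> E `` {y} = A"
    and "real (card A * card B) = c"
proof -
  have sy: "(y, x) \<in> E" if "(x, y) \<in> E" for x y using sym that by (auto dest: symD)
  have closed: "(x, w) \<in> E" if "(x, y) \<in> E" "(y, z) \<in> E" "(z, w) \<in> E" for x y z w
    using walks3_pos[OF fin that] walks[of x w] by (auto split: if_splits)
  show "A \<inter> B = {}"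
    unfolding A_def B_def using closed uv sy ir by blast
  show "E `` {x} = B" if "x \<in> A" for x
    using that uv sy closed unfolding A_def B_def by blast
  show B: "E `` {y} = A" if "y \<in> B" for y
    using that uv sy closed unfolding A_def B_def by blast
  \<comment> \<open>Inner vertices can be chosen freely from \<open>B\<close> and \<open>A\<close>,
    so the count prescribed for an edge is the product of the two sizes.\<close>
  have "{(x, y). (u, x) \<in> E \<and> (x, y) \<in> E \<and> (y, v) \<in> E} = B \<times> A"
    using B sy by (auto simp: A_def B_def)
  then have "walks3 E u v = card B * card A"
    by (simp add: walks3_def card_cartesian_product)
  then show "real (card A * card B) = c"
    using walks[of u v] uv by (simp add: mult.commute)
qed

text \<open>A block consists of the vertices reached in one or two steps. Adjacent vertices have the
  same block, so the blocks partition the graph and no arc leaves its block; the neighbourhoods of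
  the ends of any edge are the two sides of its block.\<close>

lemma complete_bipartite_decomposition:
  assumes G: "pair_graph G"
    and no_isolated: "\<forall>v \<in> pverts G. \<exists>w. (v, w) \<in> parcs G"
    and walks: "\<And>u v. real (walks3 (parcs G) u v) = (if (u, v) \<in> parcs G then c else 0)"
  obtains l :: nat and a b :: "nat \<Rightarrow> nat" and H :: "nat \<Rightarrow> 'a pair_pre_digraph"
  where "\<And>j. j \<in> {1..l} \<Longrightarrow> a j \<ge> 1 \<and> b j \<ge> 1 \<and>
      complete_bipartite_digraph (a j) (b j) (with_proj (H j)) \<and> real (a j * b j) = c"
    and "is_disjoint_union G {1..l} H"
proof -
  interpret pair_graph G by fact
  let ?E = "parcs G"
  have sym: "sym ?E" by (rule symI) (rule arcs_symmetric)
  have irr: "(x, x) \<notin> ?E" for x using no_loops'[of x x] by blast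
  have wf: "u \<in> pverts G" "v \<in> pverts G" if "(u, v) \<in> ?E" for u v
    using wellformed'[OF that] by simp_all
  note nb = neighbourhoods_complete_bipartite[OF pair_finite_arcs sym irr walks]
  define block where "block u = ?E `` {u} \<union> ?E `` (?E `` {u})" for u
  have block_edge: "block u = ?E `` {v} \<union> ?E `` {u}" if "(u, v) \<in> ?E" for u v
  proof -
    have "?E `` (?E `` {u}) = (\<Union>y\<in>?E `` {u}. ?E `` {y})" by auto
    also have "\<dots> = (\<Union>y\<in>?E `` {u}. ?E `` {v})"
      by (rule SUP_cong[OF refl nb(3)[OF that]])
    also have "\<dots> = ?E `` {v}" using that by auto
    finally show ?thesis by (auto simp: block_def)
  qed
  have block_adj: "block u = block v" if "(u, v) \<in> ?E" for u v
    using block_edge[OF that] block_edge[OF arcs_symmetric[OF that]] by blast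
  \<comment> \<open>Going to a neighbour and back: this is where isolated vertices must be
    excluded.\<close>
  have block_self: "u \<in> block u" if "u \<in> pverts G" for u
  proof -
    obtain w where "(u, w) \<in> ?E" using no_isolated \<open>u \<in> pverts G\<close> by auto
    with arcs_symmetric[OF this] show ?thesis by (auto simp: block_def)
  qed
  have block_mem: "block w = block u" if "w \<in> block u" for u w
  proof -
    consider "(u, w) \<in> ?E" | x where "(u, x) \<in> ?E" "(x, w) \<in> ?E"
      using \<open>w \<in> block u\<close> by (auto simp: block_def)
    then show ?thesis using block_adj by cases metis+
  qed
  have block_sub: "block u \<subseteq> pverts G" for u
    using wf by (auto simp: block_def)
  define CC where "CC = block ` pverts G"
  have "finite CC" using pair_finite_verts by (simp add: CC_def)
  then obtain h where h: "bij_betw h {1..card CC} CC"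
    using ex_bij_betw_nat_finite_1 by blast
  define part where "part C = \<lparr>pverts = C, parcs = ?E \<inter> C \<times> C\<rparr>" for C
  define H where "H j = part (h j)" for j
  have "\<exists>a b. a \<ge> 1 \<and> b \<ge> 1 \<and> complete_bipartite_digraph a b (with_proj (part C)) \<and>
      real (a * b) = c" if "C \<in> CC" for C
  proof -
    obtain u where u: "u \<in> pverts G" "C = block u" using \<open>C \<in> CC\<close> by (auto simp: CC_def)
    obtain v where uv: "(u, v) \<in> ?E" using no_isolated u by auto
    let ?A = "?E `` {v}" and ?B = "?E `` {u}"
    have fin: "finite ?A" "finite ?B"
      using pair_finite_verts wf by (auto intro: finite_subset[of _ "pverts G"])
    have ne: "u \<in> ?A" "v \<in> ?B" using uv arcs_symmetric by auto
    have C: "C = ?A \<union> ?B" using u block_edge[OF uv] by simp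
    have "?E \<inter> C \<times> C = ?A \<times> ?B \<union> ?B \<times> ?A"
      unfolding C using nb(1-3)[OF uv] by blast
    then have "complete_bipartite_digraph (card ?A) (card ?B) (with_proj (part C))"
      unfolding complete_bipartite_digraph_pair_def
      using C nb(1)[OF uv] fin by (auto simp: part_def)
    moreover have "card ?A \<ge> 1" "card ?B \<ge> 1"
      using fin ne by (auto simp: Suc_le_eq card_gt_0_iff)
    ultimately show ?thesis using nb(4)[OF uv] by blast
  qed
  then have "\<forall>C\<in>CC. \<exists>p. fst p \<ge> 1 \<and> snd p \<ge> 1 \<and>
      complete_bipartite_digraph (fst p) (snd p) (with_proj (part C)) \<and> real (fst p * snd p) = c"
    by fastforce
  then obtain p where p: "\<And>C. C \<in> CC \<Longrightarrow> fst (p C) \<ge> 1 \<and> snd (p C) \<ge> 1 \<and>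
      complete_bipartite_digraph (fst (p C)) (snd (p C)) (with_proj (part C)) \<and>
      real (fst (p C) * snd (p C)) = c"
    by metis
  show thesis
  proof (rule that[of "card CC" "\<lambda>j. fst (p (h j))" "\<lambda>j. snd (p (h j))" H])
    fix j assume "j \<in> {1..card CC}"
    then have "h j \<in> CC" using h by (auto simp: bij_betw_def)
    from p[OF this] show "fst (p (h j)) \<ge> 1 \<and> snd (p (h j)) \<ge> 1 \<and>
        complete_bipartite_digraph (fst (p (h j))) (snd (p (h j))) (with_proj (H j)) \<and>
        real (fst (p (h j)) * snd (p (h j))) = c"
      by (simp add: H_def)
  next
    have img: "h ` {1..card CC} = CC" and inj: "inj_on h {1..card CC}"
      using h by (auto simp: bij_betw_def)
    have disj: "C = D" if "C \<in> CC" "D \<in> CC" "w \<in> C" "w \<in> D" for C D w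
      using that block_mem unfolding CC_def by (metis imageE)
    have "disjoint_family_on (\<lambda>i. pverts (H i)) {1..card CC}"
      unfolding disjoint_family_on_def
    proof (intro ballI impI)
      fix i j assume ij: "i \<in> {1..card CC}" "j \<in> {1..card CC}" "i \<noteq> j"
      then have "h i \<noteq> h j" "h i \<in> CC" "h j \<in> CC" using inj img by (auto dest: inj_onD)
      then show "pverts (H i) \<inter> pverts (H j) = {}"
        using disj unfolding H_def part_def by fastforce
    qed
    moreover have "pverts G = (\<Union>i\<in>{1..card CC}. pverts (H i))"
    proof -
      have "(\<Union>i\<in>{1..card CC}. pverts (H i)) = \<Union> (h ` {1..card CC})"
        by (simp add: H_def part_def)
      also have "\<dots> = \<Union> CC" by (simp only: img)
      also have "\<dots> = pverts G"
        unfolding CC_def using block_self block_sub by blast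
      finally show ?thesis by simp
    qed
    moreover have "parcs G = (\<Union>i\<in>{1..card CC}. parcs (H i))"
    proof -
      have "(\<Union>i\<in>{1..card CC}. parcs (H i)) = (\<Union>C\<in>h ` {1..card CC}. ?E \<inter> C \<times> C)"
        by (simp add: H_def part_def)
      also have "\<dots> = ?E"
        unfolding img
      proof (intro equalityI subsetI)
        fix e assume "e \<in> ?E"
        then obtain u v where e: "e = (u, v)" "(u, v) \<in> ?E" by (cases e) auto
        then have "u \<in> block u" "v \<in> block u" "block u \<in> CC"
          using block_self[OF wf(1)] block_self[OF wf(2)] block_adj wf by (auto simp: CC_def)
        then show "e \<in> (\<Union>C\<in>CC. ?E \<inter> C \<times> C)" using e by auto
      qed auto
      finally show ?thesis by simp
    qed
    ultimately show "is_disjoint_union G {1..card CC} H"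
      by (simp add: is_disjoint_union_def)
  qed
qed

section \<open>Disjoint unions of complete bipartite graphs\<close>

lemma disjoint_union_same_part:
  assumes "is_disjoint_union G I H" and "\<And>j. j \<in> I \<Longrightarrow> pair_wf_digraph (H j)"
    and "j \<in> I" "u \<in> pverts (H j)" "(u, v) \<in> parcs G \<or> (v, u) \<in> parcs G"
  shows "v \<in> pverts (H j)" and "(u, v) \<in> parcs G \<longleftrightarrow> (u, v) \<in> parcs (H j)"
proof -
  \<comment> \<open>A vertex determines its part by disjointness. Since an arc has both ends in the
    part that contributes it, an arc meeting \<open>H j\<close> belongs to
    \<open>H j\<close>.\<close>
  have eq: "i = j" if "i \<in> I" "w \<in> pverts (H i)" "w \<in> pverts (H j)" for i w
    using assms(1,3) that by (auto simp: is_disjoint_union_def disjoint_family_on_def)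
  have wf: "x \<in> pverts (H i)" "y \<in> pverts (H i)" if "i \<in> I" "(x, y) \<in> parcs (H i)" for i x y
    using pair_wf_digraph.in_arcsD1[OF assms(2)] pair_wf_digraph.in_arcsD2[OF assms(2)] that
    by auto
  have arcs: "parcs G = (\<Union>i\<in>I. parcs (H i))"
    using assms(1) by (simp add: is_disjoint_union_def)
  show "v \<in> pverts (H j)"
    using assms(3-5) wf eq unfolding arcs by blast
  show "(u, v) \<in> parcs G \<longleftrightarrow> (u, v) \<in> parcs (H j)"
    using assms(3-4) wf eq unfolding arcs by blast
qed

lemma pair_wf_digraph_complete_bipartite:
  assumes "complete_bipartite_digraph a b (with_proj H)"
  shows "pair_wf_digraph H"
  using pair_graphI_complete_bipartite[OF assms]
  by (simp add: pair_graph_def pair_digraph_def pair_fin_digraph_def)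

text \<open>A walk from the side \<open>A\<close> of a part goes to \<open>B\<close>, back to
  \<open>A\<close> and again to \<open>B\<close>, each choice being free. It therefore has
  \<open>c\<close> possible pairs of inner vertices when its end lies in \<open>B\<close>, which is
  exactly adjacency, and none otherwise.\<close>

lemma walks3_disjoint_union_complete_bipartite:
  assumes U: "is_disjoint_union G I H"
    and K: "\<And>j. j \<in> I \<Longrightarrow> complete_bipartite_digraph (a j) (b j) (with_proj (H j))"
    and c: "\<And>j. j \<in> I \<Longrightarrow> a j * b j = c"
  shows "walks3 (parcs G) u v = (if (u, v) \<in> parcs G then c else 0)"
proof (cases "\<exists>x. (u, x) \<in> parcs G")
  case False
  then show ?thesis by (auto simp: walks3_def)
next
  case True
  let ?E = "parcs G"
  have wf: "pair_wf_digraph (H j)" if "j \<in> I" for j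
    using pair_wf_digraph_complete_bipartite[OF K[OF that]] .
  from True U obtain j x where j: "j \<in> I" "(u, x) \<in> parcs (H j)"
    by (auto simp: is_disjoint_union_def)
  obtain A B where AB: "pverts (H j) = A \<union> B" "A \<inter> B = {}" "card A * card B = c"
      "parcs (H j) = A \<times> B \<union> B \<times> A"
    using K[OF j(1)] c[OF j(1)] unfolding complete_bipartite_digraph_pair_def by auto
  note same = disjoint_union_same_part[OF U wf j(1)]
  have nbA: "(w, y) \<in> ?E \<longleftrightarrow> y \<in> B" "(y, w) \<in> ?E \<longleftrightarrow> y \<in> B" if "w \<in> A" for w y
    using same(1)[of w y] same(2)[of w y] same(1)[of y w] same(2)[of y w] that AB U j(1)
    by (auto simp: is_disjoint_union_def)
  have nbB: "(w, y) \<in> ?E \<longleftrightarrow> y \<in> A" "(y, w) \<in> ?E \<longleftrightarrow> y \<in> A" if "w \<in> B" for w y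
    using same(1)[of w y] same(2)[of w y] same(1)[of y w] same(2)[of y w] that AB U j(1)
    by (auto simp: is_disjoint_union_def)
  from j AB consider "u \<in> A" | "u \<in> B" by auto
  then show ?thesis
  proof cases
    case 1
    then have "{(x, y). (u, x) \<in> ?E \<and> (x, y) \<in> ?E \<and> (y, v) \<in> ?E} = (if v \<in> B then B \<times> A else {})"
      using nbA nbB AB by auto
    then show ?thesis
      using 1 nbA AB by (auto simp: walks3_def card_cartesian_product mult.commute)
  next
    case 2
    then have "{(x, y). (u, x) \<in> ?E \<and> (x, y) \<in> ?E \<and> (y, v) \<in> ?E} = (if v \<in> A then A \<times> B else {})"
      using nbA nbB AB by auto
    then show ?thesis
      using 2 nbB AB by (auto simp: walks3_def card_cartesian_product)
  qed
qed

text \<open>Arc sets of different parts are disjoint because their tails lie in disjoint vertex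
  sets. The factor 2 accounts for both orientations of each edge.\<close>

lemma card_disjoint_union_complete_bipartite:
  assumes U: "is_disjoint_union G I H" and I: "finite I"
    and K: "\<And>j. j \<in> I \<Longrightarrow> complete_bipartite_digraph (a j) (b j) (with_proj (H j))"
  shows "card (pverts G) = (\<Sum>j\<in>I. a j + b j)" and "card (parcs G) = (\<Sum>j\<in>I. 2 * (a j * b j))"
proof -
  have wf: "pair_wf_digraph (H j)" if "j \<in> I" for j
    using pair_wf_digraph_complete_bipartite[OF K[OF that]] .
  have *: "finite (pverts (H j)) \<and> card (pverts (H j)) = a j + b j \<and> finite (parcs (H j)) \<and>
      card (parcs (H j)) = 2 * (a j * b j)" if j: "j \<in> I" for j
  proof -
    obtain A B where AB: "finite (A \<union> B)" "pverts (H j) = A \<union> B" "A \<inter> B = {}"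
        "card A = a j" "card B = b j" "parcs (H j) = A \<times> B \<union> B \<times> A"
      using K[OF j] unfolding complete_bipartite_digraph_pair_def by metis
    have "(A \<times> B) \<inter> (B \<times> A) = {}" using AB by auto
    then show ?thesis using AB by (simp add: card_Un_disjoint card_cartesian_product)
  qed
  have disj: "pverts (H i) \<inter> pverts (H j) = {}" if "i \<in> I" "j \<in> I" "i \<noteq> j" for i j
    using U that by (auto simp: is_disjoint_union_def disjoint_family_on_def)
  have sub: "parcs (H i) \<subseteq> pverts (H i) \<times> UNIV" if "i \<in> I" for i
    using pair_wf_digraph.in_arcsD1[OF wf[OF that]] by auto
  have "parcs (H i) \<inter> parcs (H j) = {}" if "i \<in> I" "j \<in> I" "i \<noteq> j" for i j
    using disj[OF that] sub[OF that(1)] sub[OF that(2)] by blast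
  then have "card (\<Union>j\<in>I. parcs (H j)) = (\<Sum>j\<in>I. card (parcs (H j)))"
    using I * by (intro card_UN_disjoint) auto
  moreover have "card (\<Union>j\<in>I. pverts (H j)) = (\<Sum>j\<in>I. card (pverts (H j)))"
    using I * disj by (intro card_UN_disjoint) auto
  ultimately show "card (pverts G) = (\<Sum>j\<in>I. a j + b j)"
      "card (parcs G) = (\<Sum>j\<in>I. 2 * (a j * b j))"
    using U * by (simp_all add: is_disjoint_union_def)
qed

text \<open>Induction along an undirected path shows that it stays in the part where it starts. By
  connectedness that part covers all vertices, leaving nothing for a second, nonempty part.\<close>

lemma connected_disjoint_union:
  assumes U: "is_disjoint_union G I H" and wf: "\<And>j. j \<in> I \<Longrightarrow> pair_wf_digraph (H j)"
    and ne: "\<And>j. j \<in> I \<Longrightarrow> pverts (H j) \<noteq> {}"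
    and con: "Digraph_Component.connected (with_proj G)"
  obtains j where "I = {j}"
proof -
  have conn: "pverts G \<noteq> {}"
      "\<And>u v. u \<in> pverts G \<Longrightarrow> v \<in> pverts G \<Longrightarrow> (u, v) \<in> rtrancl_on (pverts G) ((parcs G)\<^sup>s)"
    using con by (auto simp: connected_conv)
  then obtain j u where j: "j \<in> I" "u \<in> pverts (H j)"
    using U by (auto simp: is_disjoint_union_def)
  have "v \<in> pverts (H j)" if "v \<in> pverts G" for v
  proof -
    have "u \<in> pverts G" using U j by (auto simp: is_disjoint_union_def)
    from conn(2)[OF this that] show ?thesis
    proof (induction rule: rtrancl_on_induct)
      case base then show ?case using j by simp
    next
      case (step y z)
      then show ?case using disjoint_union_same_part(1)[OF U wf j(1), of y z]
        by (auto simp: symcl_def)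
    qed
  qed
  then have sub: "pverts (H i) \<subseteq> pverts (H j)" if "i \<in> I" for i
    using U that by (auto simp: is_disjoint_union_def)
  have "i = j" if "i \<in> I" for i
  proof (rule ccontr)
    assume "i \<noteq> j"
    then have "pverts (H i) \<inter> pverts (H j) = {}"
      using U that j by (auto simp: is_disjoint_union_def disjoint_family_on_def)
    then show False using sub[OF that] ne[OF that] by auto
  qed
  then have "I = {j}" using j(1) by blast
  then show thesis by (rule that)
qed

text \<open>Each edge is the image of exactly two arcs, which are distinct since there are no
  loops.\<close>

lemma card_parcs_eq_edges:
  assumes "pair_graph G"
  shows "card (parcs G) = 2 * card (edges G)"
proof -
  interpret pair_graph G by fact
  let ?f = "\<lambda>(u, v). {u, v}"
  have im: "edges G = ?f ` parcs G" by (auto simp: edges_def)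
  have "card (parcs G) = (\<Sum>e\<in>?f ` parcs G. card {p \<in> parcs G. ?f p = e})"
    using sum.image_gen[OF pair_finite_arcs, of "\<lambda>_. 1::nat" ?f] by simp
  also have "\<dots> = (\<Sum>e\<in>?f ` parcs G. 2)"
  proof (rule sum.cong[OF refl])
    fix e assume "e \<in> ?f ` parcs G"
    then obtain u v where uv: "(u, v) \<in> parcs G" "e = {u, v}" by auto
    have *: "p \<in> parcs G \<and> ?f p = e \<longleftrightarrow> p = (u, v) \<or> p = (v, u)" for p
      using uv(1) arcs_symmetric[OF uv(1)] unfolding uv(2)
      by (cases p) (simp only: split_conv doubleton_eq_iff prod.inject, blast)
    have "{p \<in> parcs G. ?f p = e} = {(u, v), (v, u)}"
      by (rule Set.set_eqI) (simp only: * mem_Collect_eq insert_iff empty_iff simp_thms)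
    then have "card {p \<in> parcs G. ?f p = e} = card {(u, v), (v, u)}" by (rule arg_cong)
    also have "\<dots> = 2" using no_loops'[OF uv(1)] by simp
    finally show "card {p \<in> parcs G. ?f p = e} = 2" .
  qed
  finally show ?thesis by (simp add: im)
qed

subsection \<open>The adjacency matrix\<close>

lemma adj_matrix_enumeration:
  assumes "finite (pverts G)"
  obtains vs where "distinct vs" "set vs = pverts G" "adj_matrix G = adj_matrix_wrt vs G"
proof -
  let ?vs = "SOME vs. distinct vs \<and> set vs = pverts G"
  obtain ws where "distinct ws \<and> set ws = pverts G"
    using finite_distinct_list[OF assms] by auto
  then have "distinct ?vs \<and> set ?vs = pverts G"
    by (rule someI)
  then show thesis using that[of ?vs] by (simp add: adj_matrix_def)
qed

text \<open>The enumeration hidden in \<open>adj_matrix\<close> is exposed once, so that the entries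
  of the matrix and of its cube refer to the same \<open>e\<close>.\<close>

lemma adj_matrix_entries:
  assumes G: "pair_graph G"
  obtains e where "bij_betw e {..<card (pverts G)} (pverts G)"
    and "adj_matrix G \<in> carrier_mat (card (pverts G)) (card (pverts G))"
    and "\<And>i j. i < card (pverts G) \<Longrightarrow> j < card (pverts G) \<Longrightarrow>
      adj_matrix G $$ (i, j) = (if (e i, e j) \<in> parcs G then 1 else 0)"
    and "\<And>i j. i < card (pverts G) \<Longrightarrow> j < card (pverts G) \<Longrightarrow>
      (adj_matrix G ^\<^sub>m 3) $$ (i, j) = of_nat (walks3 (parcs G) (e i) (e j))"
proof -
  interpret pair_graph G by fact
  let ?V = "pverts G" and ?E = "parcs G" and ?n = "card (pverts G)" and ?M = "adj_matrix G"
  obtain vs where vs: "distinct vs" "set vs = ?V" "?M = adj_matrix_wrt vs G"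
    using adj_matrix_enumeration[OF pair_finite_verts] by blast
  have len: "length vs = ?n" using vs distinct_card[of vs] by simp
  have bij: "bij_betw ((!) vs) {..<?n} ?V"
    by (rule bij_betw_nth) (use vs len in auto)
  have M: "?M \<in> carrier_mat ?n ?n" by (simp add: vs(3) adj_matrix_wrt_def len)
  define f :: "'a \<Rightarrow> 'a \<Rightarrow> complex" where "f u v = (if (u, v) \<in> ?E then 1 else 0)" for u v
  have ent: "?M $$ (i, j) = f (vs ! i) (vs ! j)" if "i < ?n" "j < ?n" for i j
    using that by (simp add: vs(3) adj_matrix_wrt_def len f_def)
  have prod: "(X * ?M) $$ (i, j) = (\<Sum>y\<in>?V. g y * f y (vs ! j))"
    if "X \<in> carrier_mat ?n ?n" "\<And>k. k < ?n \<Longrightarrow> X $$ (i, k) = g (vs ! k)" "i < ?n" "j < ?n"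
    for X g i j
  proof -
    have "(X * ?M) $$ (i, j) = (\<Sum>k<?n. g (vs ! k) * f (vs ! k) (vs ! j))"
      using that M by (simp add: scalar_prod_def atLeast0LessThan ent)
    also have "\<dots> = (\<Sum>y\<in>?V. g y * f y (vs ! j))"
      by (rule sum.reindex_bij_betw[OF bij])
    finally show ?thesis .
  qed
  have "(?M ^\<^sub>m 3) $$ (i, j) = of_nat (walks3 ?E (vs ! i) (vs ! j))" if "i < ?n" "j < ?n" for i j
  proof -
    let ?u = "vs ! i" and ?v = "vs ! j"
    have "?M ^\<^sub>m 3 = ?M * ?M * ?M" using M by (simp add: numeral_3_eq_3)
    then have "(?M ^\<^sub>m 3) $$ (i, j) = (?M * ?M * ?M) $$ (i, j)" by (rule arg_cong)
    also have "\<dots> = (\<Sum>y\<in>?V. (\<Sum>x\<in>?V. f ?u x * f x y) * f y ?v)"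
      using that prod[OF M, of i "f ?u"] ent M by (intro prod mult_carrier_mat[OF M M]) auto
    also have "\<dots> = (\<Sum>(y, x)\<in>?V \<times> ?V. f ?u x * f x y * f y ?v)"
      by (simp add: sum_distrib_right sum.cartesian_product)
    also have "\<dots> = (\<Sum>p\<in>?V \<times> ?V.
        if (?u, snd p) \<in> ?E \<and> (snd p, fst p) \<in> ?E \<and> (fst p, ?v) \<in> ?E then 1 else 0)"
      by (rule sum.cong) (auto simp: f_def)
    also have "\<dots> = of_nat (card {p \<in> ?V \<times> ?V.
        (?u, snd p) \<in> ?E \<and> (snd p, fst p) \<in> ?E \<and> (fst p, ?v) \<in> ?E})"
      using pair_finite_verts by (simp add: sum.If_cases Int_def)
    \<comment> \<open>The outer sum ran over the last inner vertex, so the pairs are reversed;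
      \<open>prod.swap\<close> restores the order used in \<open>walks3\<close>.\<close>
    also have "card {p \<in> ?V \<times> ?V. (?u, snd p) \<in> ?E \<and> (snd p, fst p) \<in> ?E \<and> (fst p, ?v) \<in> ?E} =
        walks3 ?E ?u ?v"
      unfolding walks3_def
      by (rule bij_betw_same_card[of prod.swap], rule bij_betwI[of _ _ _ prod.swap])
        (auto dest: wellformed')
    finally show ?thesis .
  qed
  then show thesis
    using that[of "(!) vs", OF bij M] ent by (simp add: f_def)
qed

lemma adj_matrix_carrier:
  "pair_graph G \<Longrightarrow> adj_matrix G \<in> carrier_mat (card (pverts G)) (card (pverts G))"
  by (erule adj_matrix_entries)

lemma eigenvalue_adj_matrix_real:
  assumes G: "pair_graph G" and "eigenvalue (adj_matrix G) \<mu>"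
  shows "\<mu> \<in> \<real>"
proof -
  interpret pair_graph G by fact
  let ?n = "card (pverts G)" and ?M = "adj_matrix G"
  obtain e where e: "bij_betw e {..<?n} (pverts G)" and M: "?M \<in> carrier_mat ?n ?n"
    and ent: "\<And>i j. i < ?n \<Longrightarrow> j < ?n \<Longrightarrow> ?M $$ (i, j) = (if (e i, e j) \<in> parcs G then 1 else 0)"
    and ent3: "\<And>i j. i < ?n \<Longrightarrow> j < ?n \<Longrightarrow> (?M ^\<^sub>m 3) $$ (i, j) = of_nat (walks3 (parcs G) (e i) (e j))"
    by (rule adj_matrix_entries[OF G]) (rule that)
  show ?thesis
  proof (rule eigenvalue_symmetric_real[OF M _ _ assms(2)])
    fix i j assume ij: "i < ?n" "j < ?n"
    have "(e j, e i) \<in> parcs G \<longleftrightarrow> (e i, e j) \<in> parcs G" using arcs_symmetric by blast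
    then show "?M $$ (i, j) = ?M $$ (j, i)" "?M $$ (i, j) \<in> \<real>"
      using ij by (simp_all add: ent)
  qed
qed

text \<open>These are the traces of A and A^2. The first settles the case of two nonzero
  eigenvalues, where they must be opposite; the second brings the number of edges into the
  bound.\<close>

lemma sum_eigvals_adj_matrix:
  assumes G: "pair_graph G"
  shows "(\<Sum>i<card (pverts G). eigvals (adj_matrix G) ! i) = 0"
    and "(\<Sum>i<card (pverts G). (eigvals (adj_matrix G) ! i)\<^sup>2) = of_nat (card (parcs G))"
proof -
  interpret pair_graph G by fact
  let ?n = "card (pverts G)" and ?M = "adj_matrix G"
  obtain e where e: "bij_betw e {..<?n} (pverts G)" and M: "?M \<in> carrier_mat ?n ?n"
    and ent: "\<And>i j. i < ?n \<Longrightarrow> j < ?n \<Longrightarrow> ?M $$ (i, j) = (if (e i, e j) \<in> parcs G then 1 else 0)"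
    and ent3: "\<And>i j. i < ?n \<Longrightarrow> j < ?n \<Longrightarrow> (?M ^\<^sub>m 3) $$ (i, j) = of_nat (walks3 (parcs G) (e i) (e j))"
    by (rule adj_matrix_entries[OF G]) (rule that)
  have noloop: "(x, x) \<notin> parcs G" for x using no_loops'[of x x] by blast
  have "?M ^\<^sub>m 1 = ?M" using M by simp
  then show "(\<Sum>i<?n. eigvals ?M ! i) = 0"
    using mat_trace_pow_eigvals[OF M, of 1] M noloop by (simp add: mat_trace_def ent)
  have "?M ^\<^sub>m 2 = ?M * ?M" using M by (simp add: numeral_2_eq_2)
  then have "(\<Sum>i<?n. (eigvals ?M ! i)\<^sup>2) = (\<Sum>i<?n. \<Sum>j<?n. ?M $$ (i, j) * ?M $$ (j, i))"
    using mat_trace_pow_eigvals[OF M, of 2] mat_trace_mult[OF M M] by simp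
  also have "\<dots> = (\<Sum>i<?n. \<Sum>j<?n. if (e i, e j) \<in> parcs G then 1 else 0)"
  proof (intro sum.cong refl)
    fix i j assume "i \<in> {..<?n}" "j \<in> {..<?n}"
    moreover have "(e j, e i) \<in> parcs G \<longleftrightarrow> (e i, e j) \<in> parcs G" using arcs_symmetric by blast
    ultimately show "?M $$ (i, j) * ?M $$ (j, i) = (if (e i, e j) \<in> parcs G then 1 else 0)"
      by (simp add: ent)
  qed
  also have "\<dots> = (\<Sum>i<?n. \<Sum>v\<in>pverts G. if (e i, v) \<in> parcs G then 1 else 0)"
    by (intro sum.cong refl sum.reindex_bij_betw[OF e])
  also have "\<dots> = (\<Sum>u\<in>pverts G. \<Sum>v\<in>pverts G. if (u, v) \<in> parcs G then 1 else 0)"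
    by (rule sum.reindex_bij_betw[OF e])
  also have "\<dots> = (\<Sum>p\<in>pverts G \<times> pverts G. if p \<in> parcs G then 1 else 0)"
    by (simp add: sum.cartesian_product case_prod_unfold)
  also have "\<dots> = of_nat (card (pverts G \<times> pverts G \<inter> parcs G))"
    using pair_finite_verts by (simp add: sum.If_cases)
  also have "pverts G \<times> pverts G \<inter> parcs G = parcs G"
    by (auto dest: wellformed')
  finally show "(\<Sum>i<?n. (eigvals ?M ! i)\<^sup>2) = of_nat (card (parcs G))" .
qed

text \<open>The entries of the real symmetric matrix \<open>A\<^sup>3 - c A\<close> have square sum
  \<open>\<Sum>\<lambda>\<^sup>2 (\<lambda>\<^sup>2 - c)\<^sup>2\<close>, so no diagonalization is needed to see that it vanishes.\<close>

lemma walks3_of_eigvals: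
  fixes c :: real
  assumes G: "pair_graph G"
    and ev: "\<And>i. i < card (pverts G) \<Longrightarrow>
      eigvals (adj_matrix G) ! i = 0 \<or> (eigvals (adj_matrix G) ! i)\<^sup>2 = of_real c"
  shows "real (walks3 (parcs G) u v) = (if (u, v) \<in> parcs G then c else 0)"
proof (cases "u \<in> pverts G \<and> v \<in> pverts G")
  case False
  interpret pair_graph G by fact
  have none: "{(x, y). (u, x) \<in> parcs G \<and> (x, y) \<in> parcs G \<and> (y, v) \<in> parcs G} = {}"
    using False by (auto dest: wellformed')
  have "(u, v) \<notin> parcs G" using False by (auto dest: wellformed')
  then show ?thesis unfolding walks3_def none by simp
next
  case True
  interpret pair_graph G by fact
  let ?n = "card (pverts G)" and ?M = "adj_matrix G"
  obtain e where e: "bij_betw e {..<?n} (pverts G)" and M: "?M \<in> carrier_mat ?n ?n"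
    and ent: "\<And>i j. i < ?n \<Longrightarrow> j < ?n \<Longrightarrow> ?M $$ (i, j) = (if (e i, e j) \<in> parcs G then 1 else 0)"
    and ent3: "\<And>i j. i < ?n \<Longrightarrow> j < ?n \<Longrightarrow> (?M ^\<^sub>m 3) $$ (i, j) = of_nat (walks3 (parcs G) (e i) (e j))"
    by (rule adj_matrix_entries[OF G]) (rule that)
  have M3: "?M ^\<^sub>m 3 \<in> carrier_mat ?n ?n" using M by simp
  \<comment> \<open>The entries of A^3 - c A, kept real so that a vanishing sum of squares forces
    each of them to vanish.\<close>
  define r where "r i j = real (walks3 (parcs G) (e i) (e j)) -
    c * (if (e i, e j) \<in> parcs G then 1 else 0)" for i j
  have sym: "sym (parcs G)" by (rule symI) (rule arcs_symmetric)
  have r: "complex_of_real ((r i j)\<^sup>2) =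
      (?M ^\<^sub>m 3) $$ (i, j) * (?M ^\<^sub>m 3) $$ (j, i) - 2 * of_real c * ((?M ^\<^sub>m 3) $$ (i, j) * ?M $$ (j, i))
        + (of_real c)\<^sup>2 * (?M $$ (i, j) * ?M $$ (j, i))"
    if "i < ?n" "j < ?n" for i j
  proof -
    have "(e j, e i) \<in> parcs G \<longleftrightarrow> (e i, e j) \<in> parcs G" using arcs_symmetric by blast
    then show ?thesis
      using that walks3_commute[OF sym, of "e j" "e i"]
      by (simp add: r_def ent ent3 power2_eq_square algebra_simps)
  qed
  have m1: "?M ^\<^sub>m 1 = ?M" using M by simp
  \<comment> \<open>By symmetry the sum of the squared entries is the trace of (A^3 - c A)^2,
    expanded here.\<close>
  have "(\<Sum>i<?n. \<Sum>j<?n. complex_of_real ((r i j)\<^sup>2)) =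
      mat_trace (?M ^\<^sub>m 3 * ?M ^\<^sub>m 3) - 2 * of_real c * mat_trace (?M ^\<^sub>m 3 * ?M)
        + (of_real c)\<^sup>2 * mat_trace (?M * ?M)"
    unfolding mat_trace_mult[OF M3 M3] mat_trace_mult[OF M3 M] mat_trace_mult[OF M M]
    by (simp add: r sum.distrib sum_subtractf sum_distrib_left del: of_real_power)
  also have "\<dots> = mat_trace (?M ^\<^sub>m 6) - 2 * of_real c * mat_trace (?M ^\<^sub>m 4)
        + (of_real c)\<^sup>2 * mat_trace (?M ^\<^sub>m 2)"
    using pow_mat_add[OF M, of 3 3] pow_mat_add[OF M, of 3 1] pow_mat_add[OF M, of 1 1]
    unfolding m1 one_add_one by simp
  also have "\<dots> = (\<Sum>i<?n. (eigvals ?M ! i)\<^sup>2 * ((eigvals ?M ! i)\<^sup>2 - of_real c)\<^sup>2)"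
    unfolding mat_trace_pow_eigvals[OF M] sum_distrib_left sum_subtractf[symmetric] sum.distrib[symmetric]
    by (rule sum.cong) (auto simp: algebra_simps power2_eq_square eval_nat_numeral)
  also have "\<dots> = 0"
    by (rule sum.neutral) (use ev in auto)
  finally have "complex_of_real (\<Sum>i<?n. \<Sum>j<?n. (r i j)\<^sup>2) = 0" by simp
  then have "(\<Sum>i<?n. \<Sum>j<?n. (r i j)\<^sup>2) = 0" by (simp only: of_real_eq_0_iff)
  then have r0: "r i j = 0" if "i < ?n" "j < ?n" for i j
    using that by (simp add: sum_nonneg_eq_0_iff sum_nonneg)
  have "u \<in> e ` {..<?n}" "v \<in> e ` {..<?n}"
    using True bij_betw_imp_surj_on[OF e] by simp_all
  then obtain i j where "i < ?n" "j < ?n" "u = e i" "v = e j" by blast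
  with r0[of i j] show ?thesis by (auto simp: r_def split: if_splits)
qed

text \<open>The hypothesis on walks says A^3 = c A. Applied to an eigenvector and read at a nonzero
  coordinate, it gives \<mu>^3 = c \<mu>, where one \<mu> cancels.\<close>

lemma eigenvalue_of_walks3:
  assumes G: "pair_graph G"
    and walks: "\<And>u v. walks3 (parcs G) u v = (if (u, v) \<in> parcs G then c else 0)"
    and ev: "eigenvalue (adj_matrix G) \<mu>" "\<mu> \<noteq> 0"
  shows "\<mu>\<^sup>2 = of_nat c"
proof -
  let ?n = "card (pverts G)" and ?M = "adj_matrix G"
  obtain e where e: "bij_betw e {..<?n} (pverts G)" and M: "?M \<in> carrier_mat ?n ?n"
    and ent: "\<And>i j. i < ?n \<Longrightarrow> j < ?n \<Longrightarrow> ?M $$ (i, j) = (if (e i, e j) \<in> parcs G then 1 else 0)"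
    and ent3: "\<And>i j. i < ?n \<Longrightarrow> j < ?n \<Longrightarrow> (?M ^\<^sub>m 3) $$ (i, j) = of_nat (walks3 (parcs G) (e i) (e j))"
    by (rule adj_matrix_entries[OF G]) (rule that)
  have cubic: "?M ^\<^sub>m 3 = of_nat c \<cdot>\<^sub>m ?M"
    by (rule eq_matI) (use M in \<open>auto simp: ent ent3 walks\<close>)
  obtain v where v: "eigenvector ?M v \<mu>" using ev by (auto simp: eigenvalue_def)
  then have v': "v \<in> carrier_vec ?n" "v \<noteq> 0\<^sub>v ?n" "?M *\<^sub>v v = \<mu> \<cdot>\<^sub>v v"
    using M by (auto simp: eigenvector_def)
  obtain i where i: "i < ?n" "v $ i \<noteq> 0"
    using v'(1,2) by (metis carrier_vecD eq_vecI index_zero_vec)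
  have "\<mu> ^ 3 * v $ i = (?M ^\<^sub>m 3 *\<^sub>v v) $ i"
    using i v'(1) by (simp add: eigenvector_pow[OF M v])
  also have "\<dots> = of_nat c * (?M *\<^sub>v v) $ i"
    using M v'(1) i by (simp add: cubic scalar_prod_def sum_distrib_left mult.assoc)
  also have "\<dots> = of_nat c * (\<mu> * v $ i)"
    using i v' by simp
  finally show ?thesis using i ev(2) by (simp add: eval_nat_numeral)
qed

subsection \<open>The energy bound\<close>

text \<open>Any other index set of the size of \<open>I\<close> contains the index of a zero
  eigenvalue, so a single product survives in the symmetric sum.\<close>

lemma Upsilon_nonzero_eigvals:
  assumes M: "M \<in> carrier_mat n n"
  defines "I \<equiv> {i. i < n \<and> eigvals M ! i \<noteq> 0}"
  shows "Upsilon (card I) M = (\<Prod>i\<in>I. eigvals M ! i)"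
proof -
  let ?S = "{J. J \<subseteq> {..<n} \<and> card J = card I}"
  have I: "I \<in> ?S" "finite I" by (auto simp: I_def)
  have "(\<Prod>i\<in>J. eigvals M ! i) = 0" if J: "J \<in> ?S - {I}" for J
  proof -
    have "finite J" using J finite_subset[of J "{..<n}"] by auto
    moreover have "\<not> J \<subseteq> I" using J I card_subset_eq[of I J] by auto
    ultimately show ?thesis using J by (auto simp: I_def)
  qed
  then have "(\<Sum>J\<in>?S. \<Prod>i\<in>J. eigvals M ! i) = (\<Sum>J\<in>{I}. \<Prod>i\<in>J. eigvals M ! i)"
    using I by (intro sum.mono_neutral_right) auto
  then show ?thesis by (simp add: Upsilon_def eigvals(2)[OF M])
qed

text \<open>Nullity, number of arcs and the equal-modulus condition are expressed over the index set
  \<open>I\<close> to which the mean inequality is applied. Squares agree with squared moduli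
  because the eigenvalues are real.\<close>

lemma nonzero_eigvals_adj_matrix:
  assumes G: "pair_graph G"
  defines "I \<equiv> {i. i < card (pverts G) \<and> eigvals (adj_matrix G) ! i \<noteq> 0}"
  shows "card (pverts G) = card I + nullity G"
    and "(\<Sum>i\<in>I. (cmod (eigvals (adj_matrix G) ! i))\<^sup>2) = card (parcs G)"
    and "(\<forall>i\<in>I. \<forall>j\<in>I. cmod (eigvals (adj_matrix G) ! i) = cmod (eigvals (adj_matrix G) ! j)) \<longleftrightarrow>
      (\<forall>\<mu> \<nu>. eigenvalue (adj_matrix G) \<mu> \<and> \<mu> \<noteq> 0 \<and> eigenvalue (adj_matrix G) \<nu> \<and> \<nu> \<noteq> 0
         \<longrightarrow> cmod \<mu> = cmod \<nu>)"
    and "\<And>i. i \<in> I \<Longrightarrow> (eigvals (adj_matrix G) ! i)\<^sup>2 = of_real ((cmod (eigvals (adj_matrix G) ! i))\<^sup>2)"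
proof -
  let ?n = "card (pverts G)" and ?M = "adj_matrix G"
  let ?e = "\<lambda>i. eigvals ?M ! i"
  note M = adj_matrix_carrier[OF G]
  have "nullity G = card {i. i < ?n \<and> ?e i = 0}"
    unfolding nullity_def by (rule order_char_poly_eq_card[OF M])
  moreover have "{..<?n} = I \<union> {i. i < ?n \<and> ?e i = 0}" "I \<inter> {i. i < ?n \<and> ?e i = 0} = {}"
    by (auto simp: I_def)
  ultimately show "?n = card I + nullity G"
    by (metis card_Un_disjoint card_lessThan finite_Un finite_lessThan)
  have sq: "(?e i)\<^sup>2 = of_real ((cmod (?e i))\<^sup>2)" if "i < ?n" for i
  proof -
    have "?e i \<in> \<real>"
      using eigenvalue_adj_matrix_real[OF G] eigenvalue_iff_eigvals[OF M] that by blast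
    then obtain x where "?e i = of_real x" by (elim Reals_cases)
    then show ?thesis by simp
  qed
  then show "(?e i)\<^sup>2 = of_real ((cmod (?e i))\<^sup>2)" if "i \<in> I" for i
    using that by (simp add: I_def)
  have "complex_of_real (\<Sum>i\<in>I. (cmod (?e i))\<^sup>2) = of_real (\<Sum>i<?n. (cmod (?e i))\<^sup>2)"
    by (subst sum.mono_neutral_left[of "{..<?n}" I]) (auto simp: I_def)
  also have "\<dots> = (\<Sum>i<?n. (?e i)\<^sup>2)"
    by (simp add: sq del: of_real_power)
  also have "\<dots> = of_real (card (parcs G))"
    using sum_eigvals_adj_matrix(2)[OF G] by simp
  finally show "(\<Sum>i\<in>I. (cmod (?e i))\<^sup>2) = card (parcs G)"
    by (simp only: of_real_eq_iff)
  show "(\<forall>i\<in>I. \<forall>j\<in>I. cmod (?e i) = cmod (?e j)) \<longleftrightarrow>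
      (\<forall>\<mu> \<nu>. eigenvalue ?M \<mu> \<and> \<mu> \<noteq> 0 \<and> eigenvalue ?M \<nu> \<and> \<nu> \<noteq> 0 \<longrightarrow> cmod \<mu> = cmod \<nu>)"
    unfolding eigenvalue_iff_eigvals[OF M] I_def by blast
qed

text \<open>The mean inequality for the moduli of the nonzero eigenvalues; the geometric mean comes
  from \<open>Upsilon\<close>, the sum of squares from the edges.\<close>

lemma energy_bound:
  fixes G :: "'a pair_pre_digraph" and n m \<kappa> :: nat
  assumes G: "pair_graph G" and n: "n = card (pverts G)" and m: "m = card (edges G)"
    and \<kappa>: "\<kappa> = nullity G"
  defines "B \<equiv> sqrt (2 * real m + (real n - real \<kappa>) * (real n - real \<kappa> - 1) *
                    cmod (Upsilon (n - \<kappa>) (adj_matrix G)) powr (2 / (real n - real \<kappa>)))"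
  shows "B \<le> energy G"
    and "energy G = B \<longleftrightarrow>
      (\<forall>\<mu> \<nu>. eigenvalue (adj_matrix G) \<mu> \<and> \<mu> \<noteq> 0 \<and> eigenvalue (adj_matrix G) \<nu> \<and> \<nu> \<noteq> 0
         \<longrightarrow> cmod \<mu> = cmod \<nu>)"
proof -
  let ?M = "adj_matrix G"
  let ?e = "\<lambda>i. eigvals ?M ! i"
  define I where "I = {i. i < card (pverts G) \<and> ?e i \<noteq> 0}"
  note M = adj_matrix_carrier[OF G]
  note I = nonzero_eigvals_adj_matrix[OF G, folded I_def]
  define N where "N = card I"
  have N: "real n - real \<kappa> = real N" "n - \<kappa> = N"
    using I(1) by (simp_all add: n \<kappa> N_def)
  have fin: "finite I" by (simp add: I_def)
  have pos: "cmod (?e i) > 0" if "i \<in> I" for i using that by (simp add: I_def)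
  define g where "g = (\<Prod>i\<in>I. cmod (?e i)) powr (2 / real N)"
  have ups: "cmod (Upsilon N ?M) powr (2 / real N) = g"
    using Upsilon_nonzero_eigvals[OF M] by (simp add: g_def N_def I_def prod_norm)
  define X where "X = (\<Sum>i\<in>I. (cmod (?e i))\<^sup>2) + real N * (real N - 1) * g"
  have B: "B = sqrt X"
    unfolding B_def X_def N ups I(2) card_parcs_eq_edges[OF G] m by simp
  have "energy G = (\<Sum>i<card (pverts G). cmod (?e i))"
    unfolding energy_def using eigvals(2)[OF M]
    by (simp add: sum_list_sum_nth atLeast0LessThan)
  also have "\<dots> = (\<Sum>i\<in>I. cmod (?e i))"
    by (rule sum.mono_neutral_right) (auto simp: I_def)
  finally have en: "energy G = (\<Sum>i\<in>I. cmod (?e i))" .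
  have en0: "energy G \<ge> 0" by (simp add: en sum_nonneg)
  \<comment> \<open>For \<open>N = 0\<close> the second factor is negative, but the first one
    vanishes.\<close>
  have "real N * (real N - 1) \<ge> 0" by (cases N) auto
  then have X0: "X \<ge> 0" by (simp add: X_def g_def sum_nonneg)
  have le: "X \<le> (energy G)\<^sup>2"
    unfolding X_def en g_def by (rule offdiag_sum_AM_GM(1)[OF fin pos N_def[symmetric]])
  then show "B \<le> energy G"
    unfolding B using en0 by (simp add: real_le_lsqrt)
  \<comment> \<open>The exceptional equality case of the mean inequality adds nothing: with trace
    zero, two nonzero eigenvalues are negatives of each other.\<close>
  have two: "\<forall>i\<in>I. \<forall>j\<in>I. cmod (?e i) = cmod (?e j)" if "N = 2"
  proof -
    obtain a b where ab: "I = {a, b}" "a \<noteq> b"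
      using \<open>N = 2\<close> by (auto simp: N_def card_2_iff)
    have "(\<Sum>i\<in>I. ?e i) = (\<Sum>i<card (pverts G). ?e i)"
      by (rule sum.mono_neutral_left) (auto simp: I_def)
    then have "?e a + ?e b = 0"
      using sum_eigvals_adj_matrix(1)[OF G] ab by simp
    then have "?e a = - ?e b" by (simp add: eq_neg_iff_add_eq_0)
    then have "cmod (?e a) = cmod (?e b)" by simp
    then show ?thesis unfolding ab by simp
  qed
  have "energy G = B \<longleftrightarrow> (energy G)\<^sup>2 = X"
    unfolding B using en0 X0 by (auto intro: real_sqrt_unique[symmetric])
  also have "\<dots> \<longleftrightarrow> N = 2 \<or> (\<forall>i\<in>I. \<forall>j\<in>I. cmod (?e i) = cmod (?e j))"
    unfolding X_def en g_def by (rule offdiag_sum_AM_GM(2)[OF fin pos N_def[symmetric]])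
  finally show "energy G = B \<longleftrightarrow>
      (\<forall>\<mu> \<nu>. eigenvalue ?M \<mu> \<and> \<mu> \<noteq> 0 \<and> eigenvalue ?M \<nu> \<and> \<nu> \<noteq> 0 \<longrightarrow> cmod \<mu> = cmod \<nu>)"
    using I(3) two by blast
qed

subsection \<open>Graphs whose nonzero eigenvalues have equal modulus\<close>

text \<open>With \<open>c\<close> the common squared modulus, the walk counts yield the parts, each
  with product of sizes \<open>c\<close>. Their number then follows by counting arcs.\<close>

lemma equal_modulus_eigenvalues_decomposition:
  fixes G :: "'a pair_pre_digraph"
  assumes G: "pair_graph G" and no_isolated: "\<forall>v \<in> pverts G. \<exists>w. (v, w) \<in> parcs G"
    and eq: "\<forall>\<mu> \<nu>. eigenvalue (adj_matrix G) \<mu> \<and> \<mu> \<noteq> 0 \<and> eigenvalue (adj_matrix G) \<nu> \<and> \<nu> \<noteq> 0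
         \<longrightarrow> cmod \<mu> = cmod \<nu>"
  obtains l :: nat and a b :: "nat \<Rightarrow> nat" and H :: "nat \<Rightarrow> 'a pair_pre_digraph"
  where "\<And>j. j \<in> {1..l} \<Longrightarrow> a j \<ge> 1 \<and> b j \<ge> 1 \<and>
      complete_bipartite_digraph (a j) (b j) (with_proj (H j))"
    and "is_disjoint_union G {1..l} H"
    and "\<And>i j. i \<in> {1..l} \<Longrightarrow> j \<in> {1..l} \<Longrightarrow> a j * b j = a i * b i"
    and "card (pverts G) = 2 * l + nullity G"
    and "card (pverts G) = (\<Sum>j = 1..l. a j + b j)"
proof -
  let ?e = "\<lambda>i. eigvals (adj_matrix G) ! i"
  define I where "I = {i. i < card (pverts G) \<and> ?e i \<noteq> 0}"
  note I = nonzero_eigvals_adj_matrix[OF G, folded I_def]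
  obtain c where c: "\<And>i. i \<in> I \<Longrightarrow> (cmod (?e i))\<^sup>2 = c"
    using I(3) eq by metis
  have "?e i = 0 \<or> (?e i)\<^sup>2 = of_real c" if "i < card (pverts G)" for i
    using that I(4)[of i] c[of i] by (auto simp: I_def)
  note walks = walks3_of_eigvals[OF G this]
  obtain l :: nat and a b :: "nat \<Rightarrow> nat" and H :: "nat \<Rightarrow> 'a pair_pre_digraph"
    where K: "\<And>j. j \<in> {1..l} \<Longrightarrow> a j \<ge> 1 \<and> b j \<ge> 1 \<and>
        complete_bipartite_digraph (a j) (b j) (with_proj (H j)) \<and> real (a j * b j) = c"
      and U: "is_disjoint_union G {1..l} H"
    using complete_bipartite_decomposition[OF G no_isolated walks] by blast
  have cards: "card (pverts G) = (\<Sum>j = 1..l. a j + b j)" "card (parcs G) = (\<Sum>j = 1..l. 2 * (a j * b j))"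
    using card_disjoint_union_complete_bipartite[OF U, of a b] K by auto
  \<comment> \<open>The arcs number \<open>card I * c\<close> by the spectrum and
    \<open>2 * l * c\<close> by the parts. If there is a part then \<open>c\<close> is a product of
    positive sizes and cancels; otherwise the graph has no vertices.\<close>
  have "card I = 2 * l"
  proof (cases "l = 0")
    case True
    then show ?thesis using cards I(1) by simp
  next
    case False
    then have "a 1 * b 1 \<ge> 1" "real (a 1 * b 1) = c" using K[of 1] by (auto simp: Suc_le_eq)
    then have "c > 0" by linarith
    have "real (card (parcs G)) = (\<Sum>j = 1..l. 2 * real (a j * b j))"
      by (simp add: cards(2))
    also have "\<dots> = real (2 * l) * c" using K by simp
    finally have "real (card I) * c = real (2 * l) * c"
      using I(2) c by simp
    then show ?thesis using \<open>c > 0\<close> by (metis less_irrefl mult_right_cancel of_nat_eq_iff)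
  qed
  then have nul: "card (pverts G) = 2 * l + nullity G" using I(1) by simp
  have "a j * b j = a i * b i" if "i \<in> {1..l}" "j \<in> {1..l}" for i j
    using K[OF that(1)] K[OF that(2)] by (metis of_nat_eq_iff)
  with K show thesis using that[OF _ U _ nul cards(1)] by blast
qed

text \<open>Equal products give a common walk count \<open>c\<close>, and then every nonzero
  eigenvalue squares to \<open>c\<close>.\<close>

lemma decomposition_equal_modulus_eigenvalues:
  assumes G: "pair_graph G" and U: "is_disjoint_union G I H"
    and K: "\<And>j. j \<in> I \<Longrightarrow> complete_bipartite_digraph (a j) (b j) (with_proj (H j))"
    and ab: "\<And>i j. i \<in> I \<Longrightarrow> j \<in> I \<Longrightarrow> i \<noteq> j \<Longrightarrow> a j * b j = a i * b i"
    and ev: "eigenvalue (adj_matrix G) \<mu>" "\<mu> \<noteq> 0" "eigenvalue (adj_matrix G) \<nu>" "\<nu> \<noteq> 0"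
  shows "cmod \<mu> = cmod \<nu>"
proof -
  obtain c where c: "\<And>j. j \<in> I \<Longrightarrow> a j * b j = c"
    using ab by metis
  note walks = walks3_disjoint_union_complete_bipartite[OF U K c]
  have "\<mu>\<^sup>2 = \<nu>\<^sup>2"
    using eigenvalue_of_walks3[OF G walks ev(1,2)] eigenvalue_of_walks3[OF G walks ev(3,4)] by simp
  then show ?thesis by (auto simp: power2_eq_iff)
qed

theorem theorem2:
  fixes G :: "'a pair_pre_digraph" and n m \<kappa> :: nat and B :: real
  assumes "pair_graph G"
    and "n = card (pverts G)"
    and "m = card (edges G)"
    and no_isolated: "\<forall>v \<in> pverts G. \<exists>w. (v, w) \<in> parcs G"
    and "\<kappa> = nullity G"
    and bound: "B = sqrt (2 * real m + (real n - real \<kappa>) * (real n - real \<kappa> - 1) *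
                    cmod (Upsilon (n - \<kappa>) (adj_matrix G)) powr (2 / (real n - real \<kappa>)))"
  shows "energy G \<ge> B \<and>
    (energy G = B \<longleftrightarrow>
      (\<forall>\<mu> \<nu>. eigenvalue (adj_matrix G) \<mu> \<and> \<mu> \<noteq> 0 \<and> eigenvalue (adj_matrix G) \<nu> \<and> \<nu> \<noteq> 0
         \<longrightarrow> cmod \<mu> = cmod \<nu>)) \<and>
    (Digraph_Component.connected (with_proj G) \<longrightarrow>
      (energy G = B \<longleftrightarrow>
        (\<exists>a b. a \<ge> 1 \<and> b \<ge> 1 \<and> complete_bipartite_digraph a b (with_proj G) \<and> a + b = \<kappa> + 2))) \<and>
    (\<not> Digraph_Component.connected (with_proj G) \<longrightarrow>
      (energy G = B \<longleftrightarrow>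
        (\<exists>(l::nat) (a :: nat \<Rightarrow> nat) (b :: nat \<Rightarrow> nat) (H :: nat \<Rightarrow> 'a pair_pre_digraph).
           (\<forall>j \<in> {1..l}. a j \<ge> 1 \<and> b j \<ge> 1 \<and>
              complete_bipartite_digraph (a j) (b j) (with_proj (H j))) \<and>
           is_disjoint_union G {1..l} H \<and>
           (\<forall>i \<in> {1..l}. \<forall>j \<in> {1..l}. i \<noteq> j \<longrightarrow> a j * b j = a i * b i) \<and>
           real l = (real n - real \<kappa>) / 2 \<and>
           n = (\<Sum>j = 1..l. a j + b j))))"
    (is "_ \<and> (_ \<longleftrightarrow> ?EQ) \<and> (?C \<longrightarrow> (_ \<longleftrightarrow> ?K)) \<and> (_ \<longrightarrow> (_ \<longleftrightarrow> ?D))")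
proof -
  note G = \<open>pair_graph G\<close>
  have le: "B \<le> energy G" and eq: "energy G = B \<longleftrightarrow> ?EQ"
    unfolding bound using energy_bound[OF assms(1-3,5)] by blast+
  \<comment> \<open>\<open>?EQ\<close> and \<open>?D\<close> are proved equivalent for connected and
    disconnected graphs alike; in the connected case \<open>?D\<close> is then reduced to
    \<open>?K\<close>.\<close>
  have D: "?D" if EQ: ?EQ
  proof -
    obtain l a b and H :: "nat \<Rightarrow> 'a pair_pre_digraph" where
      *: "\<And>j. j \<in> {1..l} \<Longrightarrow> a j \<ge> 1 \<and> b j \<ge> 1 \<and>
        complete_bipartite_digraph (a j) (b j) (with_proj (H j))"
      "is_disjoint_union G {1..l} H"
      "\<And>i j. i \<in> {1..l} \<Longrightarrow> j \<in> {1..l} \<Longrightarrow> a j * b j = a i * b i"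
      "card (pverts G) = 2 * l + nullity G"
      "card (pverts G) = (\<Sum>j = 1..l. a j + b j)"
      using equal_modulus_eigenvalues_decomposition[OF G no_isolated EQ] by blast
    then have "real l = (real n - real \<kappa>) / 2" "n = (\<Sum>j = 1..l. a j + b j)"
      using assms(2,5) by simp_all
    with *(1-3) show ?thesis by blast
  qed
  have D_EQ: ?EQ if D: ?D
  proof -
    obtain l a b and H :: "nat \<Rightarrow> 'a pair_pre_digraph" where
      K: "\<And>j. j \<in> {1..l} \<Longrightarrow> complete_bipartite_digraph (a j) (b j) (with_proj (H j))"
      and U: "is_disjoint_union G {1..l} H"
      and ab: "\<And>i j. i \<in> {1..l} \<Longrightarrow> j \<in> {1..l} \<Longrightarrow> i \<noteq> j \<Longrightarrow> a j * b j = a i * b i"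
      using D by (elim exE conjE) blast
    show ?thesis
      using decomposition_equal_modulus_eigenvalues[OF G U K ab] by blast
  qed
  have K_EQ: ?EQ if K: ?K
  proof -
    obtain a b where "complete_bipartite_digraph a b (with_proj G)" using K by auto
    \<comment> \<open>A single complete bipartite graph is a disjoint union with one part, where the
      condition on products of different parts is vacuous.\<close>
    moreover have "is_disjoint_union G {1::nat} (\<lambda>_. G)"
      by (simp add: is_disjoint_union_def disjoint_family_on_def)
    ultimately show ?thesis
      using decomposition_equal_modulus_eigenvalues[OF G, of "{1::nat}" "\<lambda>_. G" "\<lambda>_. a" "\<lambda>_. b"]
      by blast
  qed
  have K: ?K if D: ?D and con: ?C
  proof -
    obtain l a b and H :: "nat \<Rightarrow> 'a pair_pre_digraph" where
      *: "\<And>j. j \<in> {1..l} \<Longrightarrow> a j \<ge> 1 \<and> b j \<ge> 1 \<and>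
        complete_bipartite_digraph (a j) (b j) (with_proj (H j))"
      "is_disjoint_union G {1..l} H" "real l = (real n - real \<kappa>) / 2"
      "n = (\<Sum>j = 1..l. a j + b j)"
      using D by (elim exE conjE) blast
    have "pair_wf_digraph (H j)" "pverts (H j) \<noteq> {}" if "j \<in> {1..l}" for j
      using *(1)[OF that] pair_wf_digraph_complete_bipartite[of "a j" "b j" "H j"]
      by (blast, auto simp: complete_bipartite_digraph_pair_def)
    then obtain j where j: "{1..l} = {j}"
      using connected_disjoint_union[OF *(2) _ _ con] by metis
    then have l: "l = 1" using card_atLeastAtMost[of 1 l] by simp
    have "G = H 1"
      using *(2) by (intro pair_pre_digraph.equality) (auto simp: l is_disjoint_union_def)
    \<comment> \<open>With \<open>l = 1\<close> the relation between \<open>l\<close>,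
      \<open>n\<close> and \<kappa> gives \<open>n = \<kappa> + 2\<close>, and \<open>n\<close> is
      the sum of the two sizes.\<close>
    then show ?thesis using *(1)[of 1] *(3,4) by (intro exI[of _ "a 1"] exI[of _ "b 1"]) (auto simp: l)
  qed
  show ?thesis using le eq D D_EQ K_EQ K by blast
qed

end
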